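(* Let $m$ be an odd squarefree positive integer with $m \equiv 0 \pmod 3$. Let $f : \mathbb{Z}_m^* \to [0,1]$ be a function supported on those reduced residue classes which are $\equiv 1 \pmod 3$ (that is, $f(a)=0$ whenever $a \not\equiv 1 \pmod 3$), and suppose that $$\sum_{a \in \mathbb{Z}_m^*} f(a) > \frac{\varphi(m)}{4}.$$ Then for any $x \in \mathbb{Z}_m$ with $x \equiv 0 \pmod 3$, there exist $a_1,a_2,a_3 \in \mathbb{Z}_m^*$ with $x = a_1+a_2+a_3$ in $\mathbb{Z}_m$ such that $$f(a_i) > 0 \ \text{ for } i=1,2,3, \qquad f(a_1)+f(a_2)+f(a_3) > \frac{3}{2}.$$
   Context: $\mathbb{Z}_m = \mathbb{Z}/m\mathbb{Z}$, $\mathbb{Z}_m^*$ is its group of units (the reduced residue classes modulo $m$), and $\varphi$ is Euler's totient function. Since $3 \mid m$, the residue modulo $3$ of an element of $\mathbb{Z}_m$ is well defined. *)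

theory Defs
  imports "HOL-Number_Theory.Number_Theory" "HOL-Computational_Algebra.Squarefree"
begin

end

theory Submission
  imports Defs
begin

text \<open>
  Write \<open>m = 3 * n\<close>. On the units congruent to 1 modulo 3, which correspond to the units modulo \<open>n\<close>,
  the function \<open>f\<close> has mean greater than \<open>1/2\<close>; so \<open>u = 2 * f - 1\<close> is a function on the units modulo \<open>n\<close>
  with values in \<open>{-1..1}\<close> and positive mean, where \<open>n\<close> is squarefree and coprime to 6. The wanted summands
  have \<open>u\<close>-values \<open>> -1\<close> with positive sum, and the sum is automatically right modulo 3.

  The primes dividing \<open>n\<close> are dealt with one at a time. To use a prime \<open>p\<close>, average over the
  fibres of the projection to the units modulo \<open>p\<close>, find three residues with the prescribed sum whose
  fibres still have large averages, and continue inside these fibres. Since the three fibres differ,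
  one needs a condition on triples of averages of three different functions that is inherited. Positivity
  of the sum is not enough, since it does not prevent one of the three averages from being \<open>-1\<close>. The
  condition used here is \<open>bent_positive\<close>: the three averages have positive sum when negative numbers
  count twice. Three equal positive averages satisfy it, and at single points it yields the
  conclusion.

  For one prime, the Cauchy--Davenport theorem reduces the inheritance to a statement about decreasing
  sequences \<open>u\<close>, \<open>v\<close>, \<open>w\<close> of length \<open>p - 1\<close> (\<open>forces_prime\<close>): if the triple of means is good, then so is
  \<open>(u i, v j, w k)\<close> for some \<open>i + j + k \<ge> p - 1\<close>. Suppose no such triple is good. In terms of the bent
  values \<open>a\<close>, \<open>b\<close>, \<open>c\<close> this is the linear system \<open>a i + b j + c k \<le> 0\<close>. The bent mean of \<open>u\<close> is at
  most a weighted mean of \<open>a\<close> in which the positive entries have double weight (\<open>bent_average_le\<close>), so it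
  remains to show that the three weighted means have nonpositive sum. Adding up suitable families of
  triples bounds the deviations of each sequence from its mean by the amount by which the sum of the
  means is negative, and these bounds suffice for \<open>p \<ge> 7\<close>, barely so for \<open>p = 7\<close>
  (\<open>sum_excess_le\<close>, \<open>bent_positive_of_averages\<close>).

  For \<open>p = 5\<close> the condition is not inherited by sequences. However, the final conclusion can still be
  reached from it (\<open>winning_of_averages_4\<close>), so the prime 5 is taken last.
\<close>

section \<open>Composition over coprime moduli\<close>

text \<open>The Chinese remainder bijection between units modulo \<open>m * n\<close> and pairs of units, read from pairs
  to units so that a sum over units becomes a double sum. Modulus 1 is allowed for either factor,
  which lets an induction over the prime factors start at the empty product.\<close>

lemma totatives_crt:
  fixes m n :: nat
  assumes "m > 0" "n > 0" "coprime m n"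
  shows "\<exists>e. (\<forall>a\<in>totatives m. \<forall>b\<in>totatives n.
             e a b \<in> totatives (m * n) \<and> [e a b = a] (mod m) \<and> [e a b = b] (mod n)) \<and>
           (\<forall>f :: nat \<Rightarrow> real. (\<Sum>x\<in>totatives (m * n). f x) =
             (\<Sum>a\<in>totatives m. \<Sum>b\<in>totatives n. f (e a b)))"
proof -
  consider "m = 1" | "n = 1" | "m > 1" "n > 1" using assms by linarith
  then show ?thesis
  proof cases
    case 1
    show ?thesis by (rule exI[of _ "\<lambda>a b. b"]) (use 1 in \<open>auto simp: cong_def\<close>)
  next
    case 2
    show ?thesis by (rule exI[of _ "\<lambda>a b. a"]) (use 2 in \<open>auto simp: cong_def\<close>)
  next
    case 3
    let ?r = "\<lambda>x. (x mod m, x mod n)" and ?T = "totatives (m * n)"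
    have bij: "bij_betw ?r ?T (totatives m \<times> totatives n)"
      using bij_betw_totatives[OF 3 assms(3)] .
    define e where "e a b = inv_into ?T ?r (a, b)" for a b
    have bij': "bij_betw (\<lambda>(a, b). e a b) (totatives m \<times> totatives n) ?T"
      using bij_betw_inv_into[OF bij] by (simp add: e_def case_prod_unfold)
    show ?thesis
    proof (intro exI[of _ e] conjI ballI allI)
      fix a b assume ab: "a \<in> totatives m" "b \<in> totatives n"
      have "e a b \<in> ?T" using bij' ab unfolding bij_betw_def by blast
      moreover have "?r (e a b) = (a, b)"
        using ab by (simp add: e_def bij_betw_inv_into_right[OF bij])
      ultimately show "e a b \<in> ?T" "[e a b = a] (mod m)" "[e a b = b] (mod n)"
        using ab 3 by (auto simp: cong_def totatives_less)
    next
      fix f :: "nat \<Rightarrow> real"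
      show "sum f ?T = (\<Sum>a\<in>totatives m. \<Sum>b\<in>totatives n. f (e a b))"
        using sum.reindex_bij_betw[OF bij', of f]
        by (simp add: sum.cartesian_product case_prod_unfold)
    qed
  qed
qed

definition average :: "('a \<Rightarrow> real) \<Rightarrow> 'a set \<Rightarrow> real"
  where "average f S = (\<Sum>x\<in>S. f x) / real (card S)"

lemma average_in_Icc:
  assumes "finite S" "S \<noteq> {}" "\<And>x. x \<in> S \<Longrightarrow> f x \<in> {l..u}"
  shows "average f S \<in> {l..u}"
proof -
  have c: "real (card S) > 0" using assms by (simp add: card_gt_0_iff)
  have "sum f S \<ge> real (card S) * l" "sum f S \<le> real (card S) * u"
    using sum_bounded_below[of S l f] sum_bounded_above[of S f u] assms(3) by auto
  then show ?thesis using c by (simp add: average_def field_simps)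
qed

lemma average_bij_betw:
  "bij_betw h S T \<Longrightarrow> average f T = average (f \<circ> h) S"
  by (simp add: average_def bij_betw_same_card sum.reindex_bij_betw[symmetric])

text \<open>\<open>P\<close> is a condition on three averages and \<open>Q\<close> a condition on three values. The functions are
  allowed to differ from each other even though the final application has three equal ones: after
  one prime has been dealt with, the three summands lie in different fibres, and on these the given
  function restricts to three different functions. Keeping \<open>P\<close> and \<open>Q\<close> apart is what makes
  statements for coprime moduli compose. The values are the rescaled numbers \<open>2 * f - 1\<close>.\<close>

definition forces ::
  "nat \<Rightarrow> (real \<Rightarrow> real \<Rightarrow> real \<Rightarrow> bool) \<Rightarrow> (real \<Rightarrow> real \<Rightarrow> real \<Rightarrow> bool) \<Rightarrow> bool"
  where "forces m P Q \<longleftrightarrow>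
    (\<forall>f g h. \<forall>x::nat. f \<in> totatives m \<rightarrow> {-1..1} \<longrightarrow> g \<in> totatives m \<rightarrow> {-1..1} \<longrightarrow>
       h \<in> totatives m \<rightarrow> {-1..1} \<longrightarrow>
       P (average f (totatives m)) (average g (totatives m)) (average h (totatives m)) \<longrightarrow>
       (\<exists>a\<in>totatives m. \<exists>b\<in>totatives m. \<exists>c\<in>totatives m.
          [a + b + c = x] (mod m) \<and> Q (f a) (g b) (h c)))"

lemma forcesD:
  assumes "forces m P Q"
    and "\<And>a. a \<in> totatives m \<Longrightarrow> f a \<in> {-1..1}" "\<And>a. a \<in> totatives m \<Longrightarrow> g a \<in> {-1..1}"
    and "\<And>a. a \<in> totatives m \<Longrightarrow> h a \<in> {-1..1}"
    and "P (average f (totatives m)) (average g (totatives m)) (average h (totatives m))"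
  obtains a b c where "a \<in> totatives m" "b \<in> totatives m" "c \<in> totatives m"
    "[a + b + c = x] (mod m)" "Q (f a) (g b) (h c)"
proof -
  have "f \<in> totatives m \<rightarrow> {-1..1}" "g \<in> totatives m \<rightarrow> {-1..1}" "h \<in> totatives m \<rightarrow> {-1..1}"
    using assms(2-4) by blast+
  with assms(1,5) show ?thesis unfolding forces_def using that by blast
qed

lemma forces_one: "(\<And>u v w. P u v w \<Longrightarrow> Q u v w) \<Longrightarrow> forces 1 P Q"
  by (auto simp: forces_def average_def cong_def)

text \<open>Averaging over the fibres of the projection to the units modulo \<open>m\<close> gives functions with the same
  averages. Applying the statement modulo \<open>m\<close> to them selects three fibres whose averages satisfy
  \<open>Q\<close>, and the statement modulo \<open>n\<close> then applies inside these fibres.\<close>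

lemma forces_mult:
  assumes "m > 0" "n > 0" "coprime m n" "forces m P Q" "forces n Q R"
  shows "forces (m * n) P R"
proof -
  let ?M = "totatives m" and ?N = "totatives n" and ?T = "totatives (m * n)"
  obtain e where "\<forall>a\<in>?M. \<forall>b\<in>?N. e a b \<in> ?T \<and> [e a b = a] (mod m) \<and> [e a b = b] (mod n)"
    and sum_e: "\<forall>f :: nat \<Rightarrow> real. (\<Sum>x\<in>?T. f x) = (\<Sum>a\<in>?M. \<Sum>b\<in>?N. f (e a b))"
    using totatives_crt[OF assms(1-3)] by blast
  then have e: "\<And>a b. a \<in> ?M \<Longrightarrow> b \<in> ?N \<Longrightarrow>
      e a b \<in> ?T \<and> [e a b = a] (mod m) \<and> [e a b = b] (mod n)" by blast
  define fib where "fib f a = average (\<lambda>b. f (e a b)) ?N" for f :: "nat \<Rightarrow> real" and a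
  have avg: "average (fib f) ?M = average f ?T" for f
    using totient_mult_coprime[OF assms(3)]
    by (simp add: average_def fib_def sum_e sum_divide_distrib[symmetric] totient_def)
  have fib_in: "fib f a \<in> {-1..1}" if "f \<in> ?T \<rightarrow> {-1..1}" "a \<in> ?M" for f a
    unfolding fib_def using that e assms(2) by (intro average_in_Icc) auto
  show ?thesis unfolding forces_def
  proof (intro allI impI)
    fix f g h :: "nat \<Rightarrow> real" and x
    assume f: "f \<in> ?T \<rightarrow> {-1..1}" and g: "g \<in> ?T \<rightarrow> {-1..1}" and h: "h \<in> ?T \<rightarrow> {-1..1}"
      and P: "P (average f ?T) (average g ?T) (average h ?T)"
    obtain a b c where abc: "a \<in> ?M" "b \<in> ?M" "c \<in> ?M" "[a + b + c = x] (mod m)"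
      and Q: "Q (fib f a) (fib g b) (fib h c)"
      using forcesD[OF assms(4), of "fib f" "fib g" "fib h" x] fib_in f g h P by (auto simp: avg)
    have "\<And>t. t \<in> ?N \<Longrightarrow> f (e a t) \<in> {-1..1}" "\<And>t. t \<in> ?N \<Longrightarrow> g (e b t) \<in> {-1..1}"
      "\<And>t. t \<in> ?N \<Longrightarrow> h (e c t) \<in> {-1..1}"
      using e abc f g h by blast+
    then obtain a' b' c' where abc': "a' \<in> ?N" "b' \<in> ?N" "c' \<in> ?N" "[a' + b' + c' = x] (mod n)"
      and R: "R (f (e a a')) (g (e b b')) (h (e c c'))"
      using forcesD[OF assms(5), of "\<lambda>t. f (e a t)" "\<lambda>t. g (e b t)" "\<lambda>t. h (e c t)" x] Q
      unfolding fib_def by blast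
    have "[e a a' + e b b' + e c c' = a + b + c] (mod m)"
      "[e a a' + e b b' + e c c' = a' + b' + c'] (mod n)"
      by (intro cong_add; use e abc abc' in blast)+
    then have "[e a a' + e b b' + e c c' = x] (mod m * n)"
      using abc(4) abc'(4) assms(3) by (meson cong_trans coprime_cong_mult_nat)
    then show "\<exists>a\<in>?T. \<exists>b\<in>?T. \<exists>c\<in>?T. [a + b + c = x] (mod m * n) \<and> R (f a) (g b) (h c)"
      using R e abc abc' by blast
  qed
qed

section \<open>Sums of three sets modulo a prime\<close>

definition sumset_mod :: "nat \<Rightarrow> nat set \<Rightarrow> nat set \<Rightarrow> nat set"
  where "sumset_mod p A B = (\<lambda>(a, b). (a + b) mod p) ` (A \<times> B)"

lemma inj_on_add_mod:
  fixes p t :: nat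
  shows "inj_on (\<lambda>x. (x + t) mod p) {..<p}"
proof (rule inj_onI)
  fix x y assume "x \<in> {..<p}" "y \<in> {..<p}" "(x + t) mod p = (y + t) mod p"
  then have "[x = y] (mod p)" by (metis cong_add_rcancel_nat cong_def)
  then show "x = y" using \<open>x \<in> _\<close> \<open>y \<in> _\<close> by (simp add: cong_def)
qed

text \<open>A nonzero residue generates the additive group of residues modulo a prime.\<close>

lemma translation_invariant_residues:
  fixes p d :: nat
  assumes "prime p" "\<not> p dvd d" "A \<subseteq> {..<p}" "a \<in> A"
    and inv: "\<And>x. x \<in> A \<Longrightarrow> (x + d) mod p \<in> A"
  shows "A = {..<p}"
proof
  have multiples: "(a + k * d) mod p \<in> A" for k
  proof (induction k)
    case 0
    then show ?case using assms(3,4) by auto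
  next
    case (Suc k)
    then show ?case using inv[OF Suc] by (simp add: mod_add_right_eq algebra_simps)
  qed
  show "{..<p} \<subseteq> A"
  proof
    fix y assume y: "y \<in> {..<p}"
    have "coprime d p" using assms(1,2) by (metis prime_imp_coprime coprime_commute)
    then obtain k where "[d * k = y + (p - a mod p)] (mod p)"
      using cong_solve_coprime_nat[of d p]
      by (metis cong_scalar_right mult.assoc mult_1 mult.left_commute One_nat_def)
    then have "[a + k * d = a + (y + (p - a mod p))] (mod p)"
      by (simp add: cong_add_lcancel_nat mult.commute)
    moreover have "[a + (y + (p - a mod p)) = y] (mod p)"
    proof -
      have "a < p" using assms(3,4) by auto
      then show ?thesis by (simp add: cong_def)
    qed
    ultimately have "(a + k * d) mod p = y" using y by (simp add: cong_def)
    then show "y \<in> A" using multiples[of k] by simp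
  qed
qed (use assms in auto)

text \<open>Induction on the size of \<open>B\<close> by the transform that replaces \<open>A\<close> and a translate \<open>B'\<close> of \<open>B\<close> by
  \<open>A \<union> B'\<close> and \<open>A \<inter> B'\<close>: this keeps the sum of the sizes and does not enlarge the sumset. The
  translate is chosen so that the intersection is nonempty but smaller than \<open>B\<close>.\<close>

theorem Cauchy_Davenport:
  fixes p :: nat
  assumes "prime p" "A \<subseteq> {..<p}" "B \<subseteq> {..<p}" "A \<noteq> {}" "B \<noteq> {}"
  shows "min p (card A + card B - 1) \<le> card (sumset_mod p A B)"
  using assms(2-)
proof (induction "card B" arbitrary: A B rule: less_induct)
  case less
  have p: "p > 0" using assms(1) prime_gt_0_nat by blast
  have fin: "finite A" "finite B" using less.prems finite_subset by blast+
  have finS: "finite (sumset_mod p A B)" unfolding sumset_mod_def using fin by simp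
  have shift: "card ((\<lambda>x. (x + t) mod p) ` X) = card X" if "X \<subseteq> {..<p}" for X t
    using card_image inj_on_subset[OF inj_on_add_mod that] by blast
  obtain b where b: "b \<in> B" using less.prems by blast
  have AS: "card A \<le> card (sumset_mod p A B)"
  proof -
    have "(\<lambda>x. (x + b) mod p) ` A \<subseteq> sumset_mod p A B"
      using b by (auto simp: sumset_mod_def image_iff)
    then show ?thesis using card_mono[OF finS] shift[OF less.prems(1)] by metis
  qed
  consider "card B = 1" | "A = {..<p}" | "card B > 1" "A \<noteq> {..<p}"
    using card_gt_0_iff[of B] less.prems fin by linarith
  then show ?case
  proof cases
    case 1
    then show ?thesis using AS by simp
  next
    case 2
    then show ?thesis using AS by simp
  next
    case 3
    have "B \<noteq> {b}" using 3(1) by auto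
    then obtain b' where b': "b' \<in> B" "b' \<noteq> b" using b by blast
    have lt: "b < p" "b' < p" using b b' less.prems by auto
    \<comment> \<open>\<open>A\<close> is not invariant under translation by \<open>b' - b\<close>; a witness \<open>a\<close> becomes the image of \<open>b\<close> in the
      translate, while the image of \<open>b'\<close> falls outside \<open>A\<close>.\<close>
    have nd: "\<not> p dvd (b' + (p - b))"
    proof
      assume "p dvd (b' + (p - b))"
      then have "[b + (b' + (p - b)) = b + 0] (mod p)"
        by (metis cong_add_lcancel_nat cong_0_iff)
      then show False using lt b'(2) by (simp add: cong_def)
    qed
    obtain a where a: "a \<in> A" "(a + (b' + (p - b))) mod p \<notin> A"
      using translation_invariant_residues[OF assms(1) nd less.prems(1)] less.prems(3) 3(2) by blast
    define t where "t = a + (p - b)"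
    define B' where "B' = (\<lambda>x. (x + t) mod p) ` B"
    have "(b + t) mod p = a" using lt a(1) less.prems(1) by (auto simp: t_def)
    then have aB': "a \<in> B'" unfolding B'_def using b by force
    have b'B': "(a + (b' + (p - b))) mod p \<in> B'"
      unfolding B'_def t_def using b' by (auto simp: image_iff algebra_simps)
    have B'sub: "B' \<subseteq> {..<p}" using p by (auto simp: B'_def)
    have cB': "card B' = card B" unfolding B'_def using shift less.prems by blast
    have finB': "finite B'" using fin by (simp add: B'_def)
    have lt': "card (A \<inter> B') < card B"
      unfolding cB'[symmetric] using finB' a(2) b'B' by (intro psubset_card_mono) auto
    have step: "min p (card (A \<union> B') + card (A \<inter> B') - 1) \<le> card (sumset_mod p (A \<union> B') (A \<inter> B'))"
      using lt' less.prems B'sub aB' a(1) by (intro less.hyps) auto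
    have union: "card (A \<union> B') + card (A \<inter> B') = card A + card B"
      using card_Un_Int[OF fin(1) finB'] cB' by simp
    have "sumset_mod p (A \<union> B') (A \<inter> B') \<subseteq> (\<lambda>x. (x + t) mod p) ` sumset_mod p A B"
    proof
      fix y assume "y \<in> sumset_mod p (A \<union> B') (A \<inter> B')"
      then obtain u v where uv: "u \<in> A \<union> B'" "v \<in> A" "v \<in> B'" "y = (u + v) mod p"
        by (auto simp: sumset_mod_def)
      from uv(1) have "\<exists>c\<in>A. \<exists>d\<in>B. (u + v) mod p = (c + d + t) mod p"
      proof (elim UnE)
        assume "u \<in> A"
        moreover obtain d where "d \<in> B" "v = (d + t) mod p" using uv(3) by (auto simp: B'_def)
        moreover from this have "(u + v) mod p = (u + d + t) mod p"
          by (simp add: mod_add_right_eq add.assoc)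
        ultimately show ?thesis by blast
      next
        assume "u \<in> B'"
        then obtain d where "d \<in> B" "u = (d + t) mod p" by (auto simp: B'_def)
        then have "(u + v) mod p = (v + d + t) mod p"
          by (simp add: mod_add_right_eq ac_simps)
        then show ?thesis using uv(2) \<open>d \<in> B\<close> by blast
      qed
      then obtain c d where "c \<in> A" "d \<in> B" "(u + v) mod p = (c + d + t) mod p" by blast
      then have "y = ((c + d) mod p + t) mod p" "(c + d) mod p \<in> sumset_mod p A B"
        using uv(4) by (auto simp: sumset_mod_def mod_add_left_eq)
      then show "y \<in> (\<lambda>x. (x + t) mod p) ` sumset_mod p A B" by blast
    qed
    then have "card (sumset_mod p (A \<union> B') (A \<inter> B')) \<le> card (sumset_mod p A B)"
      using card_mono finS card_image_le by (meson finite_imageI le_trans)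
    then show ?thesis using step union by simp
  qed
qed

text \<open>By the Cauchy--Davenport theorem \<open>A + B\<close> is so large that it has to meet the translated reflection
  \<open>x - C\<close>.\<close>

corollary three_sets_cover_residues:
  fixes p x :: nat
  assumes "prime p" "A \<subseteq> {..<p}" "B \<subseteq> {..<p}" "C \<subseteq> {..<p}" "A \<noteq> {}" "B \<noteq> {}" "C \<noteq> {}"
    and "p + 2 \<le> card A + card B + card C"
  obtains a b c where "a \<in> A" "b \<in> B" "c \<in> C" "[a + b + c = x] (mod p)"
proof -
  have p: "p > 0" using assms(1) prime_gt_0_nat by blast
  let ?S = "sumset_mod p A B" and ?r = "\<lambda>c. (x + (p - c)) mod p"
  have "inj_on ?r C"
  proof (rule inj_onI)
    fix c d assume cd: "c \<in> C" "d \<in> C" "?r c = ?r d"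
    then have "[p - c = p - d] (mod p)" by (metis cong_add_lcancel_nat cong_def)
    moreover have "c < p" "d < p" using cd assms(4) by auto
    ultimately have "[(p - c) + c + d = (p - d) + d + c] (mod p)"
      by (metis add.assoc add.commute cong_add_rcancel_nat)
    then have "[d = c] (mod p)" using \<open>c < p\<close> \<open>d < p\<close> by (simp add: cong_def)
    then show "c = d" using \<open>c < p\<close> \<open>d < p\<close> by (simp add: cong_def)
  qed
  then have card_r: "card (?r ` C) = card C" by (rule card_image)
  have finC: "finite C" using assms(4) finite_subset by blast
  have "card C > 0" using finC assms(7) by (simp add: card_gt_0_iff)
  then have big: "p < card ?S + card (?r ` C)"
    using Cauchy_Davenport[OF assms(1,2,3,5,6)] assms(8) card_r by (auto simp: min_def split: if_splits)
  have "?S \<inter> ?r ` C \<noteq> {}"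
  proof
    assume "?S \<inter> ?r ` C = {}"
    moreover have "?S \<union> ?r ` C \<subseteq> {..<p}" using p by (auto simp: sumset_mod_def)
    moreover have "finite ?S" "finite (?r ` C)"
      using calculation(2) finite_subset[of _ "{..<p}"] by auto
    ultimately have "card ?S + card (?r ` C) \<le> p"
      by (metis card_Un_disjoint card_lessThan card_mono finite_lessThan)
    with big show False by simp
  qed
  then obtain a b c where abc: "a \<in> A" "b \<in> B" "c \<in> C" "(a + b) mod p = ?r c"
    by (auto simp: sumset_mod_def)
  have "c < p" using abc assms(4) by auto
  have "[a + b + c = x + (p - c) + c] (mod p)" using abc(4) by (metis cong_add_rcancel_nat cong_def)
  then have "[a + b + c = x] (mod p)" using \<open>c < p\<close> by (simp add: cong_def)
  with abc that show ?thesis by blast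
qed

lemma decreasing_enumeration:
  fixes f :: "'a::linorder \<Rightarrow> real"
  assumes "finite S"
  obtains s where "bij_betw s {..<card S} S"
    and "\<And>i j. i \<le> j \<Longrightarrow> j < card S \<Longrightarrow> f (s j) \<le> f (s i)"
proof -
  define xs where "xs = sort_key (\<lambda>a. - f a) (sorted_list_of_set S)"
  have xs: "distinct xs" "set xs = S" "length xs = card S" "sorted (map (\<lambda>a. - f a) xs)"
    using assms by (auto simp: xs_def)
  show ?thesis
  proof (rule that[of "(!) xs"])
    show "bij_betw ((!) xs) {..<card S} S" using xs by (intro bij_betw_nth) auto
    show "f (xs ! j) \<le> f (xs ! i)" if "i \<le> j" "j < card S" for i j
      using sorted_nth_mono[OF xs(4), of i j] that xs(3) by simp
  qed
qed

text \<open>Modulo a prime only the decreasing rearrangements of the three functions matter. The units with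
  the \<open>i + 1\<close>, \<open>j + 1\<close> and \<open>k + 1\<close> largest values form sets of total size at least \<open>p + 2\<close> as soon as
  \<open>i + j + k \<ge> p - 1\<close>, and then they represent every residue \<open>x\<close>, with values at least
  as large as those at the positions \<open>i\<close>, \<open>j\<close>, \<open>k\<close>.\<close>

lemma forces_prime:
  assumes "prime p"
    and upward: "\<And>u v w u' v' w'. Q u v w \<Longrightarrow> u \<le> u' \<Longrightarrow> v \<le> v' \<Longrightarrow> w \<le> w' \<Longrightarrow> Q u' v' w'"
    and sequences: "\<And>u v w. \<lbrakk>\<And>i. i < p - 1 \<Longrightarrow> u i \<in> {-1..1} \<and> v i \<in> {-1..1} \<and> w i \<in> {-1..1};
        \<And>i j. i \<le> j \<Longrightarrow> j < p - 1 \<Longrightarrow> u j \<le> u i \<and> v j \<le> v i \<and> w j \<le> w i;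
        P (average u {..<p-1}) (average v {..<p-1}) (average w {..<p-1})\<rbrakk> \<Longrightarrow>
        \<exists>i<p-1. \<exists>j<p-1. \<exists>k<p-1. p - 1 \<le> i + j + k \<and> Q (u i) (v j) (w k)"
  shows "forces p P Q"
  unfolding forces_def
proof (intro allI impI)
  let ?T = "totatives p"
  fix f g h :: "nat \<Rightarrow> real" and x
  assume f: "f \<in> ?T \<rightarrow> {-1..1}" and g: "g \<in> ?T \<rightarrow> {-1..1}" and h: "h \<in> ?T \<rightarrow> {-1..1}"
    and P: "P (average f ?T) (average g ?T) (average h ?T)"
  have card: "card ?T = p - 1" and sub: "?T \<subseteq> {..<p}"
    using totatives_prime[OF assms(1)] by auto
  have en: "\<exists>s. bij_betw s {..<p-1} ?T \<and> (\<forall>i j. i \<le> j \<longrightarrow> j < p - 1 \<longrightarrow> q (s j) \<le> q (s i))"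
    for q :: "nat \<Rightarrow> real"
    using decreasing_enumeration[of ?T q] by (metis card finite_totatives)
  obtain r where r: "bij_betw r {..<p-1} ?T"
    "\<And>i j. i \<le> j \<Longrightarrow> j < p - 1 \<Longrightarrow> f (r j) \<le> f (r i)" using en[of f] by metis
  obtain s where s: "bij_betw s {..<p-1} ?T"
    "\<And>i j. i \<le> j \<Longrightarrow> j < p - 1 \<Longrightarrow> g (s j) \<le> g (s i)" using en[of g] by metis
  obtain t where t: "bij_betw t {..<p-1} ?T"
    "\<And>i j. i \<le> j \<Longrightarrow> j < p - 1 \<Longrightarrow> h (t j) \<le> h (t i)" using en[of h] by metis
  note bij = r(1) s(1) t(1) and dec = r(2) s(2) t(2)
  have mem: "r i \<in> ?T \<and> s i \<in> ?T \<and> t i \<in> ?T" if "i < p - 1" for i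
    using bij that by (auto simp: bij_betw_def)
  have "\<exists>i<p-1. \<exists>j<p-1. \<exists>k<p-1. p - 1 \<le> i + j + k \<and> Q ((f \<circ> r) i) ((g \<circ> s) j) ((h \<circ> t) k)"
  proof (rule sequences)
    show "P (average (f \<circ> r) {..<p-1}) (average (g \<circ> s) {..<p-1}) (average (h \<circ> t) {..<p-1})"
      using P by (simp only: average_bij_betw[OF bij(1), of f] average_bij_betw[OF bij(2), of g]
          average_bij_betw[OF bij(3), of h])
  qed (use dec mem f g h in \<open>auto simp: Pi_iff\<close>)
  then obtain i j k where ijk: "i < p - 1" "j < p - 1" "k < p - 1" "p - 1 \<le> i + j + k"
    and Q: "Q (f (r i)) (g (s j)) (h (t k))" by auto
  have image: "q ` {..l} \<subseteq> {..<p} \<and> q ` {..l} \<noteq> {} \<and> card (q ` {..l}) = l + 1"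
    if "bij_betw q {..<p-1} ?T" "l < p - 1" for q l
  proof -
    have "{..l} \<subseteq> {..<p-1}" using that(2) by auto
    moreover from this have "inj_on q {..l}"
      using that(1) by (metis bij_betw_def inj_on_subset)
    ultimately show ?thesis
      using that(1) sub by (auto simp: card_image bij_betw_def)
  qed
  have "p + 2 \<le> card (r ` {..i}) + card (s ` {..j}) + card (t ` {..k})"
    using ijk image[OF bij(1) ijk(1)] image[OF bij(2) ijk(2)] image[OF bij(3) ijk(3)] by simp
  then obtain a b c where abc: "a \<in> r ` {..i}" "b \<in> s ` {..j}" "c \<in> t ` {..k}" "[a + b + c = x] (mod p)"
    using three_sets_cover_residues[OF assms(1), of "r ` {..i}" "s ` {..j}" "t ` {..k}"]
      image[OF bij(1) ijk(1)] image[OF bij(2) ijk(2)] image[OF bij(3) ijk(3)] by metis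
  then obtain i' j' k' where "i' \<le> i" "j' \<le> j" "k' \<le> k" and eq: "a = r i'" "b = s j'" "c = t k'"
    by auto
  then have "Q (f a) (g b) (h c)" "a \<in> ?T" "b \<in> ?T" "c \<in> ?T"
    using upward[OF Q] dec mem ijk by auto
  then show "\<exists>a\<in>?T. \<exists>b\<in>?T. \<exists>c\<in>?T. [a + b + c = x] (mod p) \<and> Q (f a) (g b) (h c)"
    using abc(4) by blast
qed

section \<open>Bent sums of decreasing sequences\<close>

text \<open>Negative values count twice. The factor 2 is dictated by the triple \<open>(1, 1, -1)\<close>, in which a
  summand with \<open>f = 0\<close> is hidden behind a positive sum: its bent sum is exactly 0. Positivity of a bent
  sum therefore excludes a summand equal to \<open>-1\<close>, and it still holds for three equal positive numbers.\<close>

definition bent :: "real \<Rightarrow> real"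
  where "bent u = min u (2 * u)"

lemma bent_mono: "u \<le> v \<Longrightarrow> bent u \<le> bent v"
  by (auto simp: bent_def min_def)

text \<open>For a decreasing sequence this measures how unevenly the values are spread.\<close>

definition excess :: "nat \<Rightarrow> (nat \<Rightarrow> real) \<Rightarrow> nat \<Rightarrow> real"
  where "excess n a p = (\<Sum>i<p. a i - average a {..<n})"

lemma sum_lessThan_average: "(\<Sum>i<n. a i) = real n * average a {..<n}"
  by (cases "n = 0") (auto simp: average_def)

lemma excess_all [simp]: "excess n a n = 0"
  by (simp add: excess_def sum_subtractf sum_lessThan_average)

lemma excess_nonneg:
  assumes dec: "\<And>i j. i \<le> j \<Longrightarrow> j < n \<Longrightarrow> a j \<le> a i" and "p \<le> n"
  shows "0 \<le> excess n a p"
proof (cases "\<forall>i<p. average a {..<n} \<le> a i")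
  case True
  then show ?thesis by (auto simp: excess_def intro!: sum_nonneg)
next
  case False
  then obtain i where i: "i < p" "a i < average a {..<n}" by force
  have "(\<Sum>j=p..<n. a j - average a {..<n}) \<le> 0"
  proof (intro sum_nonpos)
    fix j assume "j \<in> {p..<n}"
    then have "a j \<le> a i" using i(1) by (intro dec) auto
    then show "a j - average a {..<n} \<le> 0" using i(2) by simp
  qed
  moreover have "excess n a p + (\<Sum>j=p..<n. a j - average a {..<n}) = excess n a n"
    unfolding excess_def using assms(2)
    by (metis atLeast0LessThan sum.atLeastLessThan_concat zero_le)
  ultimately show ?thesis by simp
qed

text \<open>Deviations sum to zero, so both sides can be read off the tail of the sequence. This turns the
  fourth excess, which will occur as a gain, into a gain proportional to the second.\<close>

lemma excess_2_le:
  assumes dec: "\<And>i j. i \<le> j \<Longrightarrow> j < 6 \<Longrightarrow> a j \<le> a i"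
  shows "excess 6 a 2 \<le> 2 * excess 6 a 4"
proof -
  have "a 4 \<le> a 2" "a 5 \<le> a 3" by (auto intro: dec)
  moreover note sum_lessThan_average[of a 6]
  ultimately show ?thesis by (simp add: excess_def eval_nat_numeral)
qed

text \<open>The sequences to have in mind are the bent values of three decreasing sequences of length
  \<open>n = p - 1\<close> for which no admissible triple of positions, that is, none with \<open>i + j + k \<ge> n\<close>, has a positive bent
  sum. The
  number \<open>slack\<close> below tells how far the sum of the three means lies below zero; the aim is to bound
  the excesses by it.\<close>

locale nonpositive_triples =
  fixes n :: nat and a b c :: "nat \<Rightarrow> real"
  assumes n: "even n" "6 \<le> n"
    and dec: "\<And>i j. i \<le> j \<Longrightarrow> j < n \<Longrightarrow> a j \<le> a i"
             "\<And>i j. i \<le> j \<Longrightarrow> j < n \<Longrightarrow> b j \<le> b i"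
             "\<And>i j. i \<le> j \<Longrightarrow> j < n \<Longrightarrow> c j \<le> c i"
    and triple: "\<And>i j k. i < n \<Longrightarrow> j < n \<Longrightarrow> k < n \<Longrightarrow> n \<le> i + j + k \<Longrightarrow> a i + b j + c k \<le> 0"
begin

abbreviation A where "A \<equiv> average a {..<n}"
abbreviation B where "B \<equiv> average b {..<n}"
abbreviation C where "C \<equiv> average c {..<n}"

definition slack :: real
  where "slack = - (A + B + C)"

lemma rotate: "nonpositive_triples n b c a"
  using n dec triple by unfold_locales (auto simp: algebra_simps)

lemma slack_rotate: "nonpositive_triples.slack n b c a = slack"
  using nonpositive_triples.slack_def[OF rotate] by (simp add: slack_def)

text \<open>Average the triples \<open>(i, j, n - 1 - j)\<close> over all \<open>j\<close>. They are admissible because \<open>i \<ge> 1\<close>.\<close>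

lemma deviation_le_slack:
  assumes "1 \<le> i" "i < n"
  shows "a i - A \<le> slack"
proof -
  have "(\<Sum>j<n. a i + b j + c (n - Suc j)) \<le> 0"
    using assms by (intro sum_nonpos triple) auto
  then have "real n * (a i + B + C) \<le> 0"
    by (simp add: sum.distrib sum.nat_diff_reindex sum_lessThan_average algebra_simps)
  then show ?thesis using n by (simp add: mult_le_0_iff slack_def)
qed

text \<open>For \<open>i = 0\<close> the previous pairing misses the threshold by one, and this is repaired by position 2.
  Since \<open>n\<close> is even, the triples \<open>(2, j, n - 2 - j)\<close> for even \<open>j\<close> and \<open>(0, j, n - j)\<close> for odd \<open>j\<close>
  use every position of \<open>b\<close> and of \<open>c\<close> exactly once.\<close>

lemma deviation_0_2_le_slack: "(a 0 - A) + (a 2 - A) \<le> 2 * slack"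
proof -
  obtain l where l: "n = 2 * l" using n by blast
  have split: "(\<Sum>j<n. g j) = (\<Sum>m<l. g (2 * m) + g (2 * m + 1))" for g :: "nat \<Rightarrow> real"
    unfolding l by (induction l) (auto simp: algebra_simps)
  have split': "(\<Sum>j<n. g j) = (\<Sum>m<l. g (2 * (l - Suc m)) + g (2 * (l - Suc m) + 1))"
    for g :: "nat \<Rightarrow> real"
    unfolding split by (rule sum.nat_diff_reindex[symmetric])
  have "(\<Sum>m<l. (a 2 + b (2 * m) + c (2 * (l - Suc m)))
             + (a 0 + b (2 * m + 1) + c (2 * (l - Suc m) + 1))) \<le> 0"
    using n by (intro sum_nonpos add_nonpos_nonpos triple) (auto simp: l)
  then have "real l * (a 0 + a 2) + (\<Sum>j<n. b j) + (\<Sum>j<n. c j) \<le> 0"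
    unfolding split[of b] split'[of c] by (simp add: sum.distrib algebra_simps)
  then have "real l * (a 0 + a 2 + 2 * B + 2 * C) \<le> 0"
    by (simp add: sum_lessThan_average l algebra_simps)
  moreover have "l > 0" using n l by auto
  ultimately show ?thesis by (simp add: mult_le_0_iff slack_def)
qed

text \<open>The triples \<open>(0, j, n - j)\<close> with \<open>1 \<le> j < n\<close> leave out only the first entries of \<open>b\<close> and \<open>c\<close>, so the
  first deviation of one sequence is controlled by those of the other two.\<close>

lemma first_deviation_le:
  "(real n - 1) * excess n a 1 \<le> (real n - 1) * slack + excess n b 1 + excess n c 1"
proof -
  obtain N where N: "n = Suc N" using n by (cases n) auto
  have "(\<Sum>j<N. a 0 + b (Suc j) + c (Suc (N - Suc j))) \<le> 0"
    by (intro sum_nonpos triple) (auto simp: N)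
  then have "real N * a 0 + (\<Sum>j<N. b (Suc j)) + (\<Sum>j<N. c (Suc j)) \<le> 0"
    by (simp add: sum.distrib sum.nat_diff_reindex[of "\<lambda>j. c (Suc j)"])
  moreover have "b 0 + (\<Sum>j<N. b (Suc j)) = real n * B" "c 0 + (\<Sum>j<N. c (Suc j)) = real n * C"
    using sum.lessThan_Suc_shift[of b N] sum.lessThan_Suc_shift[of c N]
    unfolding N sum_lessThan_average[symmetric] by simp_all
  ultimately show ?thesis unfolding slack_def by (simp add: excess_def N algebra_simps)
qed

lemma slack_nonneg: "0 \<le> slack"
proof -
  have "excess n a n = (\<Sum>i<3. a i - A) + (\<Sum>i=3..<n. a i - A)"
    unfolding excess_def using n sum.atLeastLessThan_concat[of 0 3 n "\<lambda>i. a i - A"]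
    by (simp add: atLeast0LessThan)
  also have "(\<Sum>i=3..<n. a i - A) \<le> real (card {3..<n}) * slack"
    by (intro sum_bounded_above deviation_le_slack) auto
  also have "(\<Sum>i<3. a i - A) \<le> 3 * slack"
    using deviation_0_2_le_slack deviation_le_slack[of 1] n by (simp add: eval_nat_numeral)
  finally have "0 \<le> (real (card {3..<n}) + 3) * slack" by (simp add: algebra_simps)
  then show ?thesis by (simp add: zero_le_mult_iff)
qed

lemma excess_le_excess_add:
  assumes "1 \<le> p" "p \<le> q" "q \<le> n"
  shows "excess n a q \<le> excess n a p + (real q - real p) * slack"
proof -
  have "excess n a q = excess n a p + (\<Sum>i=p..<q. a i - A)"
    unfolding excess_def using assms sum.atLeastLessThan_concat[of 0 p q "\<lambda>i. a i - A"]
    by (simp add: atLeast0LessThan)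
  moreover have "(\<Sum>i=p..<q. a i - A) \<le> real (card {p..<q}) * slack"
    using assms by (intro sum_bounded_above deviation_le_slack) auto
  ultimately show ?thesis using assms by (simp add: of_nat_diff)
qed

lemma excess_le:
  assumes "p = 0 \<or> 3 \<le> p" "p \<le> n"
  shows "excess n a p \<le> real p * slack"
proof (cases "p = 0")
  case False
  have "excess n a 3 \<le> 3 * slack"
    using deviation_0_2_le_slack deviation_le_slack[of 1] n by (simp add: excess_def eval_nat_numeral)
  then show ?thesis using excess_le_excess_add[of 3 p] assms False by (simp add: algebra_simps)
qed (simp add: excess_def)

end

text \<open>Reopening the locale makes the lemmas so far available for the rotated triples.\<close>

context nonpositive_triples
begin

interpretation bca: nonpositive_triples n b c a by (rule rotate)
interpretation cab: nonpositive_triples n c a b by (rule bca.rotate)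

text \<open>The three instances of \<open>first_deviation_le\<close> form a cyclic linear system that bounds each first deviation by
  \<open>(n - 1) / (n - 3)\<close> times the slack; every further deviation adds at most one slack.\<close>

lemma excess_small_le:
  assumes "1 \<le> p" "p \<le> n"
  shows "excess n a p \<le> (real p + 2 / (real n - 3)) * slack"
proof -
  define x y z s where "x = excess n a 1" "y = excess n b 1" "z = excess n c 1" "s = slack"
  note d = this
  define N where "N = real n"
  have N: "N \<ge> 6" using n by (simp add: N_def)
  have s: "bca.slack = s" "cab.slack = s"
    using slack_rotate bca.slack_rotate by (simp_all add: d)
  have x: "(N - 1) * x \<le> (N - 1) * s + (y + z)"
    and "(N - 1) * y \<le> (N - 1) * s + z + x" "(N - 1) * z \<le> (N - 1) * s + x + y"
    using first_deviation_le bca.first_deviation_le cab.first_deviation_le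
    unfolding s N_def[symmetric] d[symmetric] by auto
  then have yz: "(N - 2) * (y + z) \<le> 2 * (N - 1) * s + 2 * x" by (simp add: algebra_simps)
  have "(N - 1) * ((N - 2) * (y + z)) \<le> (N - 1) * (2 * (N - 1) * s + 2 * x)"
    using yz N by (intro mult_left_mono) auto
  also have "\<dots> \<le> (N - 1) * (2 * (N - 1) * s) + 2 * ((N - 1) * s + (y + z))"
    using x by (simp add: algebra_simps)
  finally have "N * ((N - 3) * (y + z)) \<le> N * (2 * (N - 1) * s)" by (simp add: algebra_simps)
  then have "(N - 3) * (y + z) \<le> 2 * (N - 1) * s" using N by simp
  moreover have "(N - 3) * ((N - 1) * x) \<le> (N - 3) * ((N - 1) * s + (y + z))"
    using x N by (intro mult_left_mono) auto
  ultimately have "(N - 1) * ((N - 3) * x) \<le> (N - 1) * ((N - 1) * s)" by (simp add: algebra_simps)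
  then have "(N - 3) * x \<le> (N - 1) * s" using N by (subst (asm) mult_le_cancel_left_pos) auto
  then have "x \<le> (1 + 2 / (N - 3)) * s" using N by (simp add: field_simps)
  then show ?thesis using excess_le_excess_add[of 1 p] assms by (simp add: d N_def algebra_simps)
qed

text \<open>Two such terms together never exceed the slack, whatever \<open>p \<le> n\<close> is. This settles the case that
  one of the sequences contributes no excess.\<close>

lemma excess_le_half:
  assumes "p \<le> n"
  shows "excess n a p / (real n + real p) \<le> slack / 2"
proof -
  have n6: "real n \<ge> 6" and s: "slack \<ge> 0" using n slack_nonneg by auto
  have "excess n a p \<le> (real n + real p) / 2 * slack"
  proof (cases "p = 0 \<or> 3 \<le> p")
    case True
    then have "excess n a p \<le> real p * slack" using excess_le assms by blast
    also have "\<dots> \<le> (real n + real p) / 2 * slack" using assms s by (intro mult_right_mono) auto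
    finally show ?thesis .
  next
    case False
    then have "excess n a p \<le> (real p + 2 / (real n - 3)) * slack" using excess_small_le assms by auto
    also have "\<dots> \<le> (real n + real p) / 2 * slack"
    proof (intro mult_right_mono s)
      have "2 / (real n - 3) \<le> 2 / 3" using n6 by (intro divide_left_mono) auto
      moreover have "real p \<le> 2" using False by auto
      ultimately show "real p + 2 / (real n - 3) \<le> (real n + real p) / 2" using n6 by argo
    qed
    finally show ?thesis .
  qed
  then show ?thesis using n6 by (simp add: field_simps)
qed

end

context nonpositive_triples
begin

interpretation bca: nonpositive_triples n b c a by (rule rotate)
interpretation cab: nonpositive_triples n c a b by (rule bca.rotate)

lemma slacks: "bca.slack = slack" "cab.slack = slack"
  using slack_rotate bca.slack_rotate by simp_all

text \<open>Each summand is at most \<open>1 - (n - \<delta>) / (n + p)\<close> times the slack, with \<open>\<delta> = 2 / (n - 3)\<close>. The sum of the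
  denominators is at most \<open>4 * n + 2\<close>, so the inequality between the arithmetic and the harmonic mean
  shows that the three fractions add up to at least \<open>9 * (n - \<delta>) / (4 * n + 2)\<close>. This is at least 2
  from \<open>n = 8\<close> on, but not for \<open>n = 6\<close>.\<close>

lemma sum_excess_le_large:
  assumes "8 \<le> n" "1 \<le> p" "1 \<le> q" "1 \<le> r" "p \<le> n" "q \<le> n" "r \<le> n" "p + q + r \<le> n + 2"
  shows "excess n a p / (real n + real p) + excess n b q / (real n + real q)
       + excess n c r / (real n + real r) \<le> slack"
proof -
  define N \<delta> where "N = real n" and "\<delta> = 2 / (real n - 3)"
  have N: "N \<ge> 8" using assms by (simp add: N_def)
  have \<delta>: "\<delta> \<le> 2 / 5" "\<delta> \<ge> 0" unfolding \<delta>_def using N by (simp_all add: N_def field_simps)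
  have bound: "e / (N + real t) \<le> (1 - (N - \<delta>) / (N + real t)) * slack"
    if "e \<le> (real t + \<delta>) * slack" for e t
  proof -
    have "e / (N + real t) \<le> (real t + \<delta>) * slack / (N + real t)"
      using that N by (intro divide_right_mono) auto
    also have "\<dots> = (1 - (N - \<delta>) / (N + real t)) * slack" using N by (simp add: field_simps)
    finally show ?thesis .
  qed
  define X Y Z where "X = N + real p" and "Y = N + real q" and "Z = N + real r"
  have pos: "X > 0" "Y > 0" "Z > 0" using N by (simp_all add: X_def Y_def Z_def)
  have XYZ: "X + Y + Z \<le> 4 * N + 2" using assms(8) by (simp add: X_def Y_def Z_def N_def)
  have "9 \<le> (X + Y + Z) * (1 / X + 1 / Y + 1 / Z)"
  proof -
    have two: "2 \<le> u / v + v / u" if "u > 0" "v > 0" for u v :: real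
    proof -
      have "2 * (u * v) \<le> u\<^sup>2 + v\<^sup>2" using sum_squares_bound[of u v] by (simp add: algebra_simps)
      then show ?thesis using that by (simp add: field_simps power2_eq_square)
    qed
    have "(X + Y + Z) * (1 / X + 1 / Y + 1 / Z) =
        3 + (X / Y + Y / X) + (X / Z + Z / X) + (Y / Z + Z / Y)"
      using pos by (simp add: field_simps)
    then show ?thesis using two[OF pos(1,2)] two[OF pos(1,3)] two[OF pos(2,3)] by simp
  qed
  also have "\<dots> \<le> (4 * N + 2) * (1 / X + 1 / Y + 1 / Z)"
    using XYZ pos by (intro mult_right_mono) auto
  finally have "9 / (4 * N + 2) \<le> 1 / X + 1 / Y + 1 / Z" using N by (simp add: field_simps)
  then have "(N - \<delta>) * (9 / (4 * N + 2)) \<le> (N - \<delta>) * (1 / X + 1 / Y + 1 / Z)"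
    using N \<delta> by (intro mult_left_mono) auto
  moreover have "2 \<le> (N - \<delta>) * (9 / (4 * N + 2))"
    using N \<delta> by (simp add: field_simps)
  ultimately have two: "2 \<le> (N - \<delta>) / X + (N - \<delta>) / Y + (N - \<delta>) / Z"
    by (simp add: algebra_simps)
  have "excess n a p / X + excess n b q / Y + excess n c r / Z
      \<le> (1 - (N - \<delta>) / X) * slack + (1 - (N - \<delta>) / Y) * slack + (1 - (N - \<delta>) / Z) * slack"
    unfolding X_def Y_def Z_def
    using excess_small_le[of p] bca.excess_small_le[of q] cab.excess_small_le[of r] assms
    by (intro add_mono bound) (auto simp: \<delta>_def slacks)
  also have "\<dots> = (3 - ((N - \<delta>) / X + (N - \<delta>) / Y + (N - \<delta>) / Z)) * slack"
    by (simp add: algebra_simps)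
  also have "\<dots> \<le> 1 * slack" using two slack_nonneg by (intro mult_right_mono) auto
  finally show ?thesis by (simp add: X_def Y_def Z_def N_def)
qed

end

context nonpositive_triples
begin

interpretation bca: nonpositive_triples n b c a by (rule rotate)
interpretation cab: nonpositive_triples n c a b by (rule bca.rotate)

text \<open>The triples \<open>(3, j, 3 - j)\<close> use only the first four positions of \<open>b\<close> and \<open>c\<close>. If these are well above
  average, then the deviation of \<open>a\<close> at position 3 is pushed below the slack.\<close>

lemma excess_4_5_le:
  assumes "n = 6"
  shows "4 * excess n a 4 + excess n b 4 + excess n c 4 \<le> 16 * slack"
    and "4 * excess n a 5 + excess n b 4 + excess n c 4 \<le> 20 * slack"
proof -
  have "(\<Sum>j<4. a 3 + b j + c (3 - j)) \<le> 0"
    using assms by (intro sum_nonpos triple) auto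
  then have "4 * (a 3 - A) + excess n b 4 + excess n c 4 \<le> 4 * slack"
    by (simp add: excess_def slack_def eval_nat_numeral)
  moreover have "excess n a 3 \<le> 3 * slack" using excess_le[of 3] assms by simp
  moreover have "excess n a 4 = excess n a 3 + (a 3 - A)" by (simp add: excess_def eval_nat_numeral)
  ultimately show four: "4 * excess n a 4 + excess n b 4 + excess n c 4 \<le> 16 * slack" by argo
  have "excess n a 5 \<le> excess n a 4 + slack" using excess_le_excess_add[of 4 5] assms by simp
  with four show "4 * excess n a 5 + excess n b 4 + excess n c 4 \<le> 20 * slack" by simp
qed

text \<open>For \<open>p \<ge> 4\<close> the first term can exceed a third of the slack, but then \<open>q\<close> and \<open>r\<close> are small. In the cases
  \<open>(4, 2, 2)\<close>, \<open>(5, 1, 2)\<close> and \<open>(5, 2, 1)\<close> the separate bounds add up to more than the slack, and the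
  compensation in \<open>excess_4_5_le\<close> is needed; for \<open>(4, 2, 2)\<close> it leaves no room at all.\<close>

lemma sum_excess_le_6_long:
  assumes "n = 6" "4 \<le> p" "1 \<le> q" "1 \<le> r" "p + q + r \<le> 8"
  shows "excess n a p / (6 + real p) + excess n b q / (6 + real q)
       + excess n c r / (6 + real r) \<le> slack"
proof (cases "p = 6")
  case True
  then have "excess n a p = 0" using excess_all[of n a] assms by simp
  moreover have "excess n b q / (6 + real q) \<le> slack / 2" "excess n c r / (6 + real r) \<le> slack / 2"
    using bca.excess_le_half[of q, unfolded slacks] cab.excess_le_half[of r, unfolded slacks]
      assms by simp_all
  ultimately show ?thesis by (simp only: div_0)
next
  case False
  have small: "excess n b 1 \<le> 5 / 3 * slack" "excess n b 2 \<le> 8 / 3 * slack" "excess n b 3 \<le> 3 * slack"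
    "excess n c 1 \<le> 5 / 3 * slack" "excess n c 2 \<le> 8 / 3 * slack" "excess n c 3 \<le> 3 * slack"
    using bca.excess_small_le[of 1, unfolded slacks] bca.excess_small_le[of 2, unfolded slacks]
      bca.excess_le[of 3, unfolded slacks] cab.excess_small_le[of 1, unfolded slacks]
      cab.excess_small_le[of 2, unfolded slacks] cab.excess_le[of 3, unfolded slacks] assms(1)
    by simp_all
  have half: "excess n b 2 \<le> 2 * excess n b 4" "excess n c 2 \<le> 2 * excess n c 4"
    using excess_2_le[of b] excess_2_le[of c] dec assms(1) by auto
  have nonneg: "0 \<le> excess n b 4" "0 \<le> excess n c 4" "0 \<le> slack"
    using excess_nonneg[OF dec(2)] excess_nonneg[OF dec(3)] slack_nonneg assms(1) by auto
  note facts = excess_4_5_le[OF assms(1)] small half nonneg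
  have "(p, q, r) \<in> {(4,1,1), (4,1,2), (4,2,1), (4,2,2), (4,1,3), (4,3,1), (5,1,1), (5,1,2), (5,2,1)}"
  proof -
    have "p = 4 \<or> p = 5" "q = 1 \<or> q = 2 \<or> q = 3" "r = 1 \<or> r = 2 \<or> r = 3"
      using assms False by linarith+
    then show ?thesis using assms(5) by (elim disjE) simp_all
  qed
  then show ?thesis by (elim insertE emptyE; simp del: One_nat_def; use facts in linarith)
qed

end

context nonpositive_triples
begin

interpretation bca: nonpositive_triples n b c a by (rule rotate)
interpretation cab: nonpositive_triples n c a b by (rule bca.rotate)

text \<open>A term with at most three summands in its excess is at most a third of the slack.\<close>

lemma sum_excess_le_6:
  assumes "n = 6" "1 \<le> p" "1 \<le> q" "1 \<le> r" "p + q + r \<le> 8"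
  shows "excess n a p / (6 + real p) + excess n b q / (6 + real q)
       + excess n c r / (6 + real r) \<le> slack"
proof -
  have third: "excess n a t / (6 + real t) \<le> slack / 3 \<and> excess n b t / (6 + real t) \<le> slack / 3
      \<and> excess n c t / (6 + real t) \<le> slack / 3" if "1 \<le> t" "t \<le> 3" for t
  proof -
    have "t = 1 \<or> t = 2 \<or> t = 3" using that by auto
    then show ?thesis
      using excess_small_le[of t] excess_le[of t] bca.excess_small_le[of t, unfolded slacks]
        bca.excess_le[of t, unfolded slacks] cab.excess_small_le[of t, unfolded slacks]
        cab.excess_le[of t, unfolded slacks] slack_nonneg assms(1)
      by auto
  qed
  consider "p \<le> 3" "q \<le> 3" "r \<le> 3" | "4 \<le> p" | "4 \<le> q" | "4 \<le> r" by linarith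
  then show ?thesis
  proof cases
    case 1
    then show ?thesis using third[of p] third[of q] third[of r] assms by linarith
  next
    case 2
    then show ?thesis using sum_excess_le_6_long assms by blast
  next
    case 3
    then show ?thesis using bca.sum_excess_le_6_long[of q r p, unfolded slacks] assms by simp
  next
    case 4
    then show ?thesis using cab.sum_excess_le_6_long[of r p q, unfolded slacks] assms by simp
  qed
qed

lemma sum_excess_le:
  assumes "p \<le> n" "q \<le> n" "r \<le> n" "0 < p \<Longrightarrow> 0 < q \<Longrightarrow> 0 < r \<Longrightarrow> p + q + r \<le> n + 2"
  shows "excess n a p / (real n + real p) + excess n b q / (real n + real q)
       + excess n c r / (real n + real r) \<le> slack"
proof (cases "p = 0 \<or> q = 0 \<or> r = 0")
  case True
  then have "excess n a p / (real n + real p) = 0 \<or> excess n b q / (real n + real q) = 0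
      \<or> excess n c r / (real n + real r) = 0"
    by (auto simp: excess_def)
  moreover note excess_le_half[OF assms(1)] bca.excess_le_half[OF assms(2), unfolded slacks]
    cab.excess_le_half[OF assms(3), unfolded slacks] slack_nonneg
  ultimately show ?thesis by argo
next
  case False
  then have sum: "p + q + r \<le> n + 2" using assms(4) by simp
  have "n = 6 \<or> 8 \<le> n" using n by presburger
  then show ?thesis
    using sum_excess_le_6[of p q r] sum_excess_le_large[of p q r] False sum assms(1-3) by auto
qed

end

text \<open>With \<open>a = bent \<circ> u\<close> one has \<open>2 * u i = a i + max 0 (a i)\<close>. Hence \<open>2 * n\<close> times the mean of \<open>u\<close> is
  the sum of \<open>a\<close> in which the first \<open>p\<close> entries, the positive ones, count twice. These weights have total
  \<open>n + p\<close>, and since \<open>2 * n / (n + p)\<close> lies between 1 and 2, multiplication by it bounds \<open>bent\<close> from above.\<close>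

lemma bent_average_le:
  fixes n :: nat
  assumes dec: "\<And>i j. i \<le> j \<Longrightarrow> j < n \<Longrightarrow> u j \<le> u i" and "n > 0"
  shows "\<exists>p\<le>n. (\<forall>i<n. 0 < bent (u i) \<longleftrightarrow> i < p) \<and>
           bent (average u {..<n}) \<le>
           average (\<lambda>i. bent (u i)) {..<n} + excess n (\<lambda>i. bent (u i)) p / (real n + real p)"
proof -
  define p where "p = card {i. i < n \<and> 0 < u i}"
  have "{i. i < n \<and> 0 < u i} \<subseteq> {..<n}" by auto
  then have pn: "p \<le> n" using card_mono[of "{..<n}" "{i. i < n \<and> 0 < u i}"] by (simp add: p_def)
  have pos: "0 < u i \<longleftrightarrow> i < p" if "i < n" for i
  proof
    assume "0 < u i"
    then have "{..i} \<subseteq> {i. i < n \<and> 0 < u i}" using dec[of _ i] that by force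
    then show "i < p" unfolding p_def using card_mono[of "{i. i < n \<and> 0 < u i}" "{..i}"] by simp
  next
    assume "i < p"
    show "0 < u i"
    proof (rule ccontr)
      assume "\<not> 0 < u i"
      then have "j < i" if "j < n" "0 < u j" for j
        using dec[of i j] that by (cases "i \<le> j") auto
      then have "{j. j < n \<and> 0 < u j} \<subseteq> {..<i}" by auto
      then have "p \<le> i" using card_mono[of "{..<i}" "{j. j < n \<and> 0 < u j}"] by (simp add: p_def)
      with \<open>i < p\<close> show False by simp
    qed
  qed
  have pos': "0 < bent (u i) \<longleftrightarrow> i < p" if "i < n" for i
    using pos[OF that] by (auto simp: bent_def)
  let ?a = "\<lambda>i. bent (u i)"
  let ?A = "average ?a {..<n}" and ?U = "average u {..<n}"
  have "2 * real n * ?U = (\<Sum>i<n. 2 * u i)" by (simp add: sum_lessThan_average flip: sum_distrib_left)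
  also have "\<dots> = (\<Sum>i<n. ?a i + (if i \<in> {..<p} then ?a i else 0))"
  proof (intro sum.cong refl)
    fix i assume "i \<in> {..<n}"
    then show "2 * u i = ?a i + (if i \<in> {..<p} then ?a i else 0)"
      using pos[of i] by (cases "i < p") (auto simp: bent_def min_def)
  qed
  also have "\<dots> = (\<Sum>i<n. ?a i) + (\<Sum>i<p. ?a i)"
  proof -
    have "(\<Sum>i<n. if i \<in> {..<p} then ?a i else 0) = (\<Sum>i\<in>{..<n} \<inter> {..<p}. ?a i)"
      by (rule sum.inter_restrict[symmetric]) simp
    also have "{..<n} \<inter> {..<p} = {..<p}" using pn by auto
    finally show ?thesis by (simp only: sum.distrib)
  qed
  also have "\<dots> = (real n + real p) * ?A + excess n ?a p"
    by (simp add: sum_lessThan_average[of _ n] excess_def sum_subtractf algebra_simps)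
  finally have eq: "2 * real n / (real n + real p) * ?U = ?A + excess n ?a p / (real n + real p)"
    using assms(2) by (simp add: field_simps)
  have t: "1 \<le> 2 * real n / (real n + real p)" "2 * real n / (real n + real p) \<le> 2"
    using pn assms(2) by (simp_all add: field_simps)
  have "bent ?U \<le> 2 * real n / (real n + real p) * ?U"
  proof (cases "0 \<le> ?U")
    case True
    then show ?thesis using mult_right_mono[OF t(1) True] by (auto simp: bent_def min_def)
  next
    case False
    then show ?thesis using mult_right_mono_neg[OF t(2), of ?U] by (auto simp: bent_def min_def)
  qed
  then show ?thesis using pn pos' eq by auto
qed

definition bent_positive :: "real \<Rightarrow> real \<Rightarrow> real \<Rightarrow> bool"
  where "bent_positive u v w \<longleftrightarrow> 0 < bent u + bent v + bent w"

text \<open>The bound of \<open>sum_excess_le\<close> cancels exactly the negative sum of the means of the bent values.\<close>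

lemma bent_positive_of_averages:
  fixes n :: nat
  assumes n: "even n" "6 \<le> n"
    and decr: "\<And>i j. i \<le> j \<Longrightarrow> j < n \<Longrightarrow> u j \<le> u i \<and> v j \<le> v i \<and> w j \<le> w i"
    and avg: "bent_positive (average u {..<n}) (average v {..<n}) (average w {..<n})"
  shows "\<exists>i<n. \<exists>j<n. \<exists>k<n. n \<le> i + j + k \<and> bent_positive (u i) (v j) (w k)"
proof (rule ccontr)
  assume neg: "\<not> ?thesis"
  let ?a = "\<lambda>i. bent (u i)" and ?b = "\<lambda>i. bent (v i)" and ?c = "\<lambda>i. bent (w i)"
  interpret nonpositive_triples n ?a ?b ?c
  proof unfold_locales
    show "?a i + ?b j + ?c k \<le> 0" if "i < n" "j < n" "k < n" "n \<le> i + j + k" for i j k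
      using neg that unfolding bent_positive_def not_less[symmetric] by blast
  qed (use n decr in \<open>auto simp: bent_mono\<close>)
  have n0: "n > 0" using n by simp
  have d: "\<And>i j. i \<le> j \<Longrightarrow> j < n \<Longrightarrow> u j \<le> u i" "\<And>i j. i \<le> j \<Longrightarrow> j < n \<Longrightarrow> v j \<le> v i"
    "\<And>i j. i \<le> j \<Longrightarrow> j < n \<Longrightarrow> w j \<le> w i" using decr by auto
  obtain p where p: "p \<le> n" "\<forall>i<n. 0 < ?a i \<longleftrightarrow> i < p"
    "bent (average u {..<n}) \<le> A + excess n ?a p / (real n + real p)"
    using bent_average_le[of n u, OF d(1) n0] by blast
  obtain q where q: "q \<le> n" "\<forall>i<n. 0 < ?b i \<longleftrightarrow> i < q"
    "bent (average v {..<n}) \<le> B + excess n ?b q / (real n + real q)"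
    using bent_average_le[of n v, OF d(2) n0] by blast
  obtain r where r: "r \<le> n" "\<forall>i<n. 0 < ?c i \<longleftrightarrow> i < r"
    "bent (average w {..<n}) \<le> C + excess n ?c r / (real n + real r)"
    using bent_average_le[of n w, OF d(3) n0] by blast
  \<comment> \<open>Otherwise the last positive entries of the three sequences would form an admissible triple.\<close>
  have "p + q + r \<le> n + 2" if "0 < p" "0 < q" "0 < r"
  proof (rule ccontr)
    assume "\<not> p + q + r \<le> n + 2"
    then have "?a (p - 1) + ?b (q - 1) + ?c (r - 1) \<le> 0"
      using that p(1) q(1) r(1) by (intro triple) auto
    moreover have "0 < ?a (p - 1)" "0 < ?b (q - 1)" "0 < ?c (r - 1)"
      using that p q r by auto
    ultimately show False by simp
  qed
  then have "excess n ?a p / (real n + real p) + excess n ?b q / (real n + real q)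
       + excess n ?c r / (real n + real r) \<le> slack"
    using sum_excess_le[OF p(1) q(1) r(1)] by blast
  then show False using p(3) q(3) r(3) avg by (simp add: slack_def bent_positive_def)
qed

section \<open>Sequences of length four\<close>

text \<open>In terms of \<open>f\<close>, with \<open>u = 2 * f - 1\<close>: all three values are positive and their sum exceeds \<open>3 / 2\<close>.\<close>

definition winning :: "real \<Rightarrow> real \<Rightarrow> real \<Rightarrow> bool"
  where "winning u v w \<longleftrightarrow> - 1 < u \<and> - 1 < v \<and> - 1 < w \<and> 0 < u + v + w"

text \<open>Here \<open>p\<close>, \<open>q\<close>, \<open>r\<close> count the entries above \<open>-1\<close>. In each case the claim is a linear consequence of the
  listed triples, of the bounds \<open>-1\<close> and \<open>1\<close> for the entries and of \<open>w 3 \<le> w 2\<close>; a sequence with at most two entries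
  above \<open>-1\<close> has a nonpositive mean, and for it the factor 2 in \<open>bent\<close> is used.\<close>

lemma not_bent_positive_4_ordered:
  fixes u v w :: "nat \<Rightarrow> real"
  assumes range: "\<And>i. i < 4 \<Longrightarrow> u i \<in> {-1..1}" "\<And>i. i < 4 \<Longrightarrow> v i \<in> {-1..1}"
      "\<And>i. i < 4 \<Longrightarrow> w i \<in> {-1..1}"
    and dec: "w 3 \<le> w 2"
    and count: "\<And>i. i < 4 \<Longrightarrow> - 1 < u i \<longleftrightarrow> i < p" "\<And>i. i < 4 \<Longrightarrow> - 1 < v i \<longleftrightarrow> i < q"
      "\<And>i. i < 4 \<Longrightarrow> - 1 < w i \<longleftrightarrow> i < r"
    and le: "p \<le> q" "q \<le> r" "r \<le> 4"
    and T: "\<And>i j k. i < p \<Longrightarrow> j < q \<Longrightarrow> k < r \<Longrightarrow> 4 \<le> i + j + k \<Longrightarrow> u i + v j + w k \<le> 0"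
  shows "bent (average u {..<4}) + bent (average v {..<4}) + bent (average w {..<4}) \<le> 0"
proof -
  have sum4: "average s {..<4} = (s 0 + s 1 + s 2 + s 3) / 4" for s :: "nat \<Rightarrow> real"
    by (simp add: average_def eval_nat_numeral)
  have bent_le: "4 * bent (average s {..<4}) \<le> s 0 + s 1 + s 2 + s 3"
    "2 * bent (average s {..<4}) \<le> s 0 + s 1 + s 2 + s 3" for s :: "nat \<Rightarrow> real"
    by (simp_all add: bent_def sum4 min_def)
  note sums = bent_le[of u] bent_le[of v] bent_le[of w]
  have bounds: "u 0 \<le> 1" "u 1 \<le> 1" "u 2 \<le> 1" "- 1 \<le> u 1" "v 0 \<le> 1" "v 1 \<le> 1" "v 2 \<le> 1"
    "w 0 \<le> 1" "w 1 \<le> 1" "w 2 \<le> 1" "w 3 \<le> 1" "v 3 \<le> 1" "- 1 \<le> w 2" "w 3 \<le> w 2"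
    using range[of 0] range[of 1] range[of 2] range[of 3] dec by auto
  have low: "p \<le> i \<Longrightarrow> i < 4 \<Longrightarrow> u i = -1" "q \<le> i \<Longrightarrow> i < 4 \<Longrightarrow> v i = -1"
    "r \<le> i \<Longrightarrow> i < 4 \<Longrightarrow> w i = -1" for i
    using count[of i] range[of i] by force+
  have "p = 0 \<or> (p, q, r) \<in> {(1,1,1), (1,1,2), (1,1,3), (1,1,4), (1,2,2), (1,2,3), (1,2,4), (1,3,3),
    (1,3,4), (1,4,4), (2,2,2), (2,2,3), (2,2,4), (2,3,3), (2,3,4), (2,4,4), (3,3,3), (3,3,4),
    (3,4,4), (4,4,4)}"
  proof -
    have "p = 0 \<or> p = 1 \<or> p = 2 \<or> p = 3 \<or> p = 4" "r = 0 \<or> r = 1 \<or> r = 2 \<or> r = 3 \<or> r = 4"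
      "q = 0 \<or> q = 1 \<or> q = 2 \<or> q = 3 \<or> q = 4" using le by linarith+
    then show ?thesis using le by (elim disjE) simp_all
  qed
  then consider "p = 0"
    | "p = 1" "q = 1"
    | "p = 1" "q = 2"
    | "p = 1" "q = 3" "r = 3"
    | "p = 1" "q = 3" "r = 4"
    | "p = 1" "q = 4" "r = 4"
    | "p = 2" "q = 2" "r = 2"
    | "p = 2" "q = 2" "r = 3"
    | "p = 2" "q = 2" "r = 4"
    | "p = 2" "q = 3" "r = 3"
    | "p = 2" "q = 3" "r = 4"
    | "p = 2" "q = 4" "r = 4"
    | "p = 3" "q = 3" "r = 3"
    | "p = 3" "q = 3" "r = 4"
    | "p = 3" "q = 4" "r = 4"
    | "p = 4" "q = 4" "r = 4"
    by (elim disjE insertE emptyE Pair_inject; simp)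
  then show ?thesis
  proof cases
    case 1
    then have "u 0 = -1" "u 1 = -1" "u 2 = -1" "u 3 = -1" by (simp_all add: low)
    then show ?thesis using sums bounds by argo
  next
    case 2
    then have "u 1 = -1" "u 2 = -1" "u 3 = -1" "v 1 = -1" "v 2 = -1" "v 3 = -1"
      by (simp_all add: low)
    then show ?thesis using sums bounds by argo
  next
    case 3
    then have "u 1 = -1" "u 2 = -1" "u 3 = -1" "v 2 = -1" "v 3 = -1"
      by (simp_all add: low)
    then show ?thesis using sums bounds by argo
  next
    case 4
    then have "u 0 + v 2 + w 2 \<le> 0"
      by (simp_all add: T)
    moreover have "u 1 = -1" "u 2 = -1" "u 3 = -1" "v 3 = -1" "w 3 = -1"
      using 4 by (simp_all add: low)
    ultimately show ?thesis using sums bounds by argo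
  next
    case 5
    then have "u 0 + v 1 + w 3 \<le> 0" "u 0 + v 2 + w 2 \<le> 0"
      by (simp_all add: T)
    moreover have "u 1 = -1" "u 2 = -1" "u 3 = -1" "v 3 = -1"
      using 5 by (simp_all add: low)
    ultimately show ?thesis using sums bounds by argo
  next
    case 6
    then have "u 0 + v 1 + w 3 \<le> 0" "u 0 + v 2 + w 2 \<le> 0" "u 0 + v 3 + w 1 \<le> 0"
      by (simp_all add: T)
    moreover have "u 1 = -1" "u 2 = -1" "u 3 = -1"
      using 6 by (simp_all add: low)
    ultimately show ?thesis using sums bounds by argo
  next
    case 7
    then have "u 2 = -1" "u 3 = -1" "v 2 = -1" "v 3 = -1" "w 2 = -1" "w 3 = -1"
      by (simp_all add: low)
    then show ?thesis using sums bounds by argo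
  next
    case 8
    then have "u 1 + v 1 + w 2 \<le> 0"
      by (simp_all add: T)
    moreover have "u 2 = -1" "u 3 = -1" "v 2 = -1" "v 3 = -1" "w 3 = -1"
      using 8 by (simp_all add: low)
    ultimately show ?thesis using sums bounds by argo
  next
    case 9
    then have "u 1 + v 1 + w 2 \<le> 0"
      by (simp_all add: T)
    moreover have "u 2 = -1" "u 3 = -1" "v 2 = -1" "v 3 = -1"
      using 9 by (simp_all add: low)
    ultimately show ?thesis using sums bounds by argo
  next
    case 10
    then have "u 1 + v 1 + w 2 \<le> 0" "u 1 + v 2 + w 1 \<le> 0"
      by (simp_all add: T)
    moreover have "u 2 = -1" "u 3 = -1" "v 3 = -1" "w 3 = -1"
      using 10 by (simp_all add: low)
    ultimately show ?thesis using sums bounds by argo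
  next
    case 11
    then have "u 1 + v 1 + w 2 \<le> 0" "u 1 + v 2 + w 1 \<le> 0" "u 1 + v 0 + w 3 \<le> 0"
      by (simp_all add: T)
    moreover have "u 2 = -1" "u 3 = -1" "v 3 = -1"
      using 11 by (simp_all add: low)
    ultimately show ?thesis using sums bounds by argo
  next
    case 12
    then have "u 1 + v 0 + w 3 \<le> 0" "u 1 + v 1 + w 2 \<le> 0" "u 1 + v 2 + w 1 \<le> 0" "u 1 + v 3 + w 0 \<le> 0"
      by (simp_all add: T)
    moreover have "u 2 = -1" "u 3 = -1"
      using 12 by (simp_all add: low)
    ultimately show ?thesis using sums bounds by argo
  next
    case 13
    then have "u 1 + v 1 + w 2 \<le> 0" "u 1 + v 2 + w 1 \<le> 0" "u 2 + v 1 + w 1 \<le> 0" "u 0 + v 2 + w 2 \<le> 0" "u 2 + v 0 + w 2 \<le> 0" "u 2 + v 2 + w 0 \<le> 0"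
      by (simp_all add: T)
    moreover have "u 3 = -1" "v 3 = -1" "w 3 = -1"
      using 13 by (simp_all add: low)
    ultimately show ?thesis using sums bounds by argo
  next
    case 14
    then have "u 0 + v 1 + w 3 \<le> 0" "u 1 + v 2 + w 1 \<le> 0" "u 2 + v 0 + w 2 \<le> 0"
      by (simp_all add: T)
    moreover have "u 3 = -1" "v 3 = -1"
      using 14 by (simp_all add: low)
    ultimately show ?thesis using sums bounds by argo
  next
    case 15
    then have "u 0 + v 3 + w 1 \<le> 0" "u 1 + v 0 + w 3 \<le> 0" "u 2 + v 2 + w 0 \<le> 0" "u 1 + v 1 + w 2 \<le> 0"
      by (simp_all add: T)
    moreover have "u 3 = -1"
      using 15 by (simp_all add: low)
    ultimately show ?thesis using sums bounds by argo
  next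
    case 16
    then have "u 0 + v 1 + w 3 \<le> 0" "u 1 + v 3 + w 0 \<le> 0" "u 3 + v 0 + w 1 \<le> 0" "u 2 + v 2 + w 2 \<le> 0"
      by (simp_all add: T)
    then show ?thesis using sums bounds by argo
  qed
qed

text \<open>For \<open>n = 4\<close> positivity of the bent sum need not pass from the means to a triple with \<open>i + j + k \<ge> 4\<close>: if all three
  sequences are \<open>1, 1/4, -1/4, -5/8\<close>, then the means are positive but no bent sum over such a triple is. The weaker conclusion \<open>winning\<close> does pass.\<close>

lemma winning_of_averages_4:
  fixes u v w :: "nat \<Rightarrow> real"
  assumes range: "\<And>i. i < 4 \<Longrightarrow> u i \<in> {-1..1} \<and> v i \<in> {-1..1} \<and> w i \<in> {-1..1}"
    and dec: "\<And>i j. i \<le> j \<Longrightarrow> j < 4 \<Longrightarrow> u j \<le> u i \<and> v j \<le> v i \<and> w j \<le> w i"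
    and avg: "bent_positive (average u {..<4}) (average v {..<4}) (average w {..<4})"
  shows "\<exists>i<4. \<exists>j<4. \<exists>k<4. 4 \<le> i + j + k \<and> winning (u i) (v j) (w k)"
proof (rule ccontr)
  assume neg: "\<not> ?thesis"
  have count: "\<exists>p\<le>4. \<forall>i<4. - 1 < s i \<longleftrightarrow> i < p"
    if "\<And>i j. i \<le> j \<Longrightarrow> j < 4 \<Longrightarrow> s j \<le> s i" for s :: "nat \<Rightarrow> real"
  proof (cases "\<exists>i<4. \<not> - 1 < s i")
    case True
    define p where "p = (LEAST i. i < 4 \<and> \<not> - 1 < s i)"
    have p: "p < 4" "\<not> - 1 < s p" using LeastI_ex[OF True] by (simp_all add: p_def)
    have "- 1 < s i \<longleftrightarrow> i < p" if "i < 4" for i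
    proof (cases "i < p")
      case True
      then show ?thesis using not_less_Least[of i] that unfolding p_def by blast
    next
      case False
      then show ?thesis using p \<open>\<And>i j. i \<le> j \<Longrightarrow> j < 4 \<Longrightarrow> s j \<le> s i\<close>[of p i] that by auto
    qed
    then show ?thesis using p(1) by (intro exI[of _ p]) auto
  qed auto
  obtain p where p: "p \<le> 4" "\<forall>i<4. - 1 < u i \<longleftrightarrow> i < p" using count[of u] dec by blast
  obtain q where q: "q \<le> 4" "\<forall>i<4. - 1 < v i \<longleftrightarrow> i < q" using count[of v] dec by blast
  obtain r where r: "r \<le> 4" "\<forall>i<4. - 1 < w i \<longleftrightarrow> i < r" using count[of w] dec by blast
  have T: "u i + v j + w k \<le> 0" if "i < p" "j < q" "k < r" "4 \<le> i + j + k" for i j k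
  proof -
    have ijk: "i < 4" "j < 4" "k < 4" using that p(1) q(1) r(1) by auto
    then have "- 1 < u i" "- 1 < v j" "- 1 < w k" using that p(2) q(2) r(2) by auto
    then show ?thesis using neg ijk that(4) unfolding winning_def not_less[symmetric] by blast
  qed
  have d: "u 3 \<le> u 2" "v 3 \<le> v 2" "w 3 \<le> w 2" using dec[of 2 3] by auto
  note ordered = not_bent_positive_4_ordered
  consider "p \<le> q" "q \<le> r" | "p \<le> r" "r \<le> q" | "q \<le> p" "p \<le> r" | "q \<le> r" "r \<le> p"
    | "r \<le> p" "p \<le> q" | "r \<le> q" "q \<le> p" by linarith
  then have "bent (average u {..<4}) + bent (average v {..<4}) + bent (average w {..<4}) \<le> 0"
  proof cases
    case 1
    show ?thesis
      by (rule ordered[of u v w p q r]) (use 1 range d p q r T in \<open>auto simp: ac_simps\<close>)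
  next
    case 2
    have "bent (average u {..<4}) + bent (average w {..<4}) + bent (average v {..<4}) \<le> 0"
    proof (rule ordered[of u w v p r q])
      fix i j k assume "i < p" "j < r" "k < q" "4 \<le> i + j + k"
      then show "u i + w j + v k \<le> 0"
        using T[of i k j] by simp
    qed (use 2 range d p q r in auto)
    then show ?thesis by simp
  next
    case 3
    have "bent (average v {..<4}) + bent (average u {..<4}) + bent (average w {..<4}) \<le> 0"
    proof (rule ordered[of v u w q p r])
      fix i j k assume "i < q" "j < p" "k < r" "4 \<le> i + j + k"
      then show "v i + u j + w k \<le> 0"
        using T[of j i k] by simp
    qed (use 3 range d p q r in auto)
    then show ?thesis by simp
  next
    case 4
    have "bent (average v {..<4}) + bent (average w {..<4}) + bent (average u {..<4}) \<le> 0"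
    proof (rule ordered[of v w u q r p])
      fix i j k assume "i < q" "j < r" "k < p" "4 \<le> i + j + k"
      then show "v i + w j + u k \<le> 0"
        using T[of k i j] by simp
    qed (use 4 range d p q r in auto)
    then show ?thesis by simp
  next
    case 5
    have "bent (average w {..<4}) + bent (average u {..<4}) + bent (average v {..<4}) \<le> 0"
    proof (rule ordered[of w u v r p q])
      fix i j k assume "i < r" "j < p" "k < q" "4 \<le> i + j + k"
      then show "w i + u j + v k \<le> 0"
        using T[of j k i] by simp
    qed (use 5 range d p q r in auto)
    then show ?thesis by simp
  next
    case 6
    have "bent (average w {..<4}) + bent (average v {..<4}) + bent (average u {..<4}) \<le> 0"
    proof (rule ordered[of w v u r q p])
      fix i j k assume "i < r" "j < q" "k < p" "4 \<le> i + j + k"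
      then show "w i + v j + u k \<le> 0"
        using T[of k j i] by simp
    qed (use 6 range d p q r in auto)
    then show ?thesis by simp
  qed
  with avg show False by (simp add: bent_positive_def)
qed

section \<open>All primes together\<close>

lemma forces_conseq:
  assumes "forces m P Q"
    and "\<And>u v w. u \<in> {-1..1} \<Longrightarrow> v \<in> {-1..1} \<Longrightarrow> w \<in> {-1..1} \<Longrightarrow> Q u v w \<Longrightarrow> R u v w"
  shows "forces m P R"
  unfolding forces_def
proof (intro allI impI)
  let ?T = "totatives m"
  fix f g h :: "nat \<Rightarrow> real" and x
  assume f: "f \<in> ?T \<rightarrow> {-1..1}" and g: "g \<in> ?T \<rightarrow> {-1..1}" and h: "h \<in> ?T \<rightarrow> {-1..1}"
    and P: "P (average f ?T) (average g ?T) (average h ?T)"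
  obtain a b c where abc: "a \<in> ?T" "b \<in> ?T" "c \<in> ?T" "[a + b + c = x] (mod m)"
    and Q: "Q (f a) (g b) (h c)"
    using forcesD[OF assms(1), of f g h x] f g h P by blast
  have "R (f a) (g b) (h c)"
    using f g h abc by (intro assms(2) Q) (simp_all add: Pi_iff)
  with abc show "\<exists>a\<in>?T. \<exists>b\<in>?T. \<exists>c\<in>?T. [a + b + c = x] (mod m) \<and> R (f a) (g b) (h c)"
    by blast
qed

text \<open>The bent sum is at most the sum, and if, say, \<open>u = -1\<close>, then it is at most \<open>-2 + 1 + 1\<close>.\<close>

lemma bent_positive_imp_winning:
  assumes "u \<in> {-1..1}" "v \<in> {-1..1}" "w \<in> {-1..1}" "bent_positive u v w"
  shows "winning u v w"
  using assms unfolding bent_positive_def winning_def bent_def min_def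
  by (simp split: if_splits)

lemma bent_positive_mono:
  "bent_positive u v w \<Longrightarrow> u \<le> u' \<Longrightarrow> v \<le> v' \<Longrightarrow> w \<le> w' \<Longrightarrow> bent_positive u' v' w'"
  using bent_mono[of u u'] bent_mono[of v v'] bent_mono[of w w'] by (simp add: bent_positive_def)

lemma forces_bent_prime:
  assumes "prime p" "7 \<le> p"
  shows "forces p bent_positive bent_positive"
proof (rule forces_prime[OF assms(1) bent_positive_mono])
  have "odd p" using assms prime_odd_nat by simp
  then have n: "even (p - 1)" "6 \<le> p - 1" using assms(2) by auto
  fix u v w :: "nat \<Rightarrow> real"
  assume "\<And>i j. i \<le> j \<Longrightarrow> j < p - 1 \<Longrightarrow> u j \<le> u i \<and> v j \<le> v i \<and> w j \<le> w i"
    and "bent_positive (average u {..<p-1}) (average v {..<p-1}) (average w {..<p-1})"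
  then show "\<exists>i<p-1. \<exists>j<p-1. \<exists>k<p-1. p - 1 \<le> i + j + k \<and> bent_positive (u i) (v j) (w k)"
    by (rule bent_positive_of_averages[OF n])
qed

lemma forces_winning_5: "forces 5 bent_positive winning"
proof (rule forces_prime)
  fix u v w :: "nat \<Rightarrow> real"
  assume "\<And>i. i < 5 - 1 \<Longrightarrow> u i \<in> {-1..1} \<and> v i \<in> {-1..1} \<and> w i \<in> {-1..1}"
    and "\<And>i j. i \<le> j \<Longrightarrow> j < 5 - 1 \<Longrightarrow> u j \<le> u i \<and> v j \<le> v i \<and> w j \<le> w i"
    and "bent_positive (average u {..<5-1}) (average v {..<5-1}) (average w {..<5-1})"
  then show "\<exists>i<5-1. \<exists>j<5-1. \<exists>k<5-1. 5 - 1 \<le> i + j + k \<and> winning (u i) (v j) (w k)"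
    using winning_of_averages_4[of u v w] by simp
qed (auto simp: winning_def)

lemma squarefree_mult_imp_coprime:
  fixes a b :: nat
  assumes "squarefree (a * b)"
  shows "coprime a b"
proof (rule coprimeI)
  fix c assume "c dvd a" "c dvd b"
  then have "c\<^sup>2 dvd a * b" by (simp add: power2_eq_square mult_dvd_mono)
  then show "is_unit c" using assms squarefreeD by blast
qed

lemma forces_bent:
  assumes "squarefree k" "coprime k 30"
  shows "forces k bent_positive bent_positive"
  using assms
proof (induction k rule: less_induct)
  case (less k)
  have "k \<noteq> 0" using less.prems(1) by (metis not_squarefree_0)
  show ?case
  proof (cases "k = 1")
    case True
    then show ?thesis using forces_one by simp
  next
    case False
    then obtain p l where p: "prime p" and k: "k = p * l"
      by (metis prime_factor_nat dvdE)
    have l: "0 < l" "l < k" "squarefree l" "coprime p l"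
      using \<open>k \<noteq> 0\<close> less.prems(1) prime_gt_1_nat[OF p] squarefree_multD squarefree_mult_imp_coprime
      unfolding k by auto
    have cop: "coprime p 30" "coprime l 30" using less.prems(2) unfolding k by simp_all
    have "7 \<le> p"
    proof (rule ccontr)
      assume "\<not> 7 \<le> p"
      then have "p = 2 \<or> p = 3 \<or> p = 4 \<or> p = 5 \<or> p = 6" using prime_gt_1_nat[OF p] by arith
      moreover have "p dvd 30 \<Longrightarrow> False" using cop(1) p by (metis coprime_absorb_left not_prime_unit)
      moreover have "p \<noteq> 4" "p \<noteq> 6"
        using p prime_odd_nat[of p] by auto
      ultimately show False by auto
    qed
    then show ?thesis
      unfolding k using forces_mult[OF _ l(1,4) forces_bent_prime[OF p]] less.IH[OF l(2,3) cop(2)]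
        prime_gt_0_nat[OF p] by blast
  qed
qed

text \<open>The prime 5 has to be treated last, because \<open>winning\<close> is too weak a condition on averages to be the
  hypothesis for another prime.\<close>

lemma forces_winning:
  assumes "squarefree n" "coprime n 6"
  shows "forces n bent_positive winning"
proof (cases "5 dvd n")
  case True
  then obtain k where n: "n = 5 * k" by blast
  have k: "squarefree k" "coprime 5 k" "0 < k"
    using assms(1) squarefree_multD squarefree_mult_imp_coprime unfolding n
    by (auto intro!: Nat.gr0I)
  have "coprime k (5 * 6)"
    using k(2) assms(2) unfolding n by (simp only: coprime_mult_left_iff coprime_mult_right_iff coprime_commute)
  then have "forces k bent_positive bent_positive" using forces_bent k(1) by simp
  then have "forces (k * 5) bent_positive winning"
    using forces_mult[of k 5] forces_winning_5 k by (simp add: coprime_commute)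
  then show ?thesis by (simp add: n mult.commute)
next
  case False
  then have "coprime n 5" using prime_imp_coprime[of 5 n] by (simp add: coprime_commute)
  then have "coprime n (5 * 6)" using assms(2) by (simp only: coprime_mult_right_iff)
  then have "forces n bent_positive bent_positive" using forces_bent assms(1) by simp
  then show ?thesis using forces_conseq bent_positive_imp_winning by metis
qed

theorem theorem1p2:
  fixes m :: nat and f :: "int \<Rightarrow> real" and x :: int
  assumes "m > 0" and "odd m" and "squarefree m" and "[m = 0] (mod 3)"
    and "f \<in> Units (residue_ring (int m)) \<rightarrow> {0..1}"
    and "\<forall>a \<in> Units (residue_ring (int m)). \<not> [a = 1] (mod 3) \<longrightarrow> f a = 0"
    and "(\<Sum>a \<in> Units (residue_ring (int m)). f a) > real (totient m) / 4"
    and "x \<in> carrier (residue_ring (int m))" and "[x = 0] (mod 3)"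
  shows "\<exists>a\<^sub>1 \<in> Units (residue_ring (int m)). \<exists>a\<^sub>2 \<in> Units (residue_ring (int m)).
         \<exists>a\<^sub>3 \<in> Units (residue_ring (int m)).
           x = a\<^sub>1 \<oplus>\<^bsub>residue_ring (int m)\<^esub> a\<^sub>2 \<oplus>\<^bsub>residue_ring (int m)\<^esub> a\<^sub>3 \<and>
           f a\<^sub>1 > 0 \<and> f a\<^sub>2 > 0 \<and> f a\<^sub>3 > 0 \<and> f a\<^sub>1 + f a\<^sub>2 + f a\<^sub>3 > 3 / 2"
proof -
  have "3 dvd m" using assms(4) by (simp add: cong_0_iff)
  then obtain n where m: "m = 3 * n" by blast
  have n: "0 < n" "squarefree n" "coprime 3 n"
    using assms(1,3) squarefree_multD squarefree_mult_imp_coprime unfolding m by auto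
  have "odd n" using assms(2) by (simp add: m)
  then have "coprime n 2" by simp
  moreover have "coprime n 3" using n(3) by (simp add: coprime_commute)
  ultimately have "coprime n (2 * 3)" by (simp only: coprime_mult_right_iff)
  then have win: "forces n bent_positive winning" using forces_winning n(2) by simp
  let ?R = "residue_ring (int m)" and ?N = "totatives n" and ?T = "totatives m"
  interpret residues "int m" ?R by unfold_locales (use assms(1) m in auto)
  have units: "Units ?R = int ` ?T"
  proof -
    have "int ` nat ` Units ?R = (\<lambda>a. a) ` Units ?R"
      unfolding image_image by (intro image_cong refl) (auto simp: res_units_eq)
    then show ?thesis using totatives_eq by simp
  qed
  obtain e where "\<forall>a\<in>totatives 3. \<forall>b\<in>?N.
      e a b \<in> totatives (3 * n) \<and> [e a b = a] (mod 3) \<and> [e a b = b] (mod n)"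
    and "\<forall>q :: nat \<Rightarrow> real. (\<Sum>y\<in>totatives (3 * n). q y) =
      (\<Sum>a\<in>totatives 3. \<Sum>b\<in>?N. q (e a b))"
    using totatives_crt[OF zero_less_numeral n(1,3)] by (elim exE conjE) (rule that)
  note e = this(1)[folded m, THEN bspec, THEN bspec] and sum_e = this(2)[folded m, THEN spec]
  have "totatives 3 = {0<..<3}" by (rule totatives_prime) simp
  also have "{0<..<3::nat} = {1, 2}" by (auto simp: greaterThanLessThan_def)
  finally have T3: "totatives 3 = {1, 2}" .
  have e1: "e 1 b \<in> ?T" "[e 1 b = 1] (mod 3)" "[e 1 b = b] (mod n)" if "b \<in> ?N" for b
    using e[of 1 b] that by (simp_all add: T3)
  have f0: "f (int (e 2 b)) = 0" if "b \<in> ?N" for b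
  proof -
    have "e 2 b \<in> ?T" "[e 2 b = 2] (mod 3)" using e[of 2 b] that by (simp_all add: T3)
    then have "[int (e 2 b) = int 2] (mod int 3)" by (simp only: cong_int_iff)
    then have "\<not> [int (e 2 b) = 1] (mod 3)" by (simp add: cong_def)
    then show ?thesis using assms(6) \<open>e 2 b \<in> ?T\<close> units by blast
  qed
  have "(\<Sum>a\<in>Units ?R. f a) = (\<Sum>y\<in>?T. f (int y))"
    unfolding units by (simp add: sum.reindex)
  also have "\<dots> = (\<Sum>b\<in>?N. f (int (e 1 b)))" by (simp add: sum_e T3 f0)
  finally have sum: "real (card ?N) / 2 < (\<Sum>b\<in>?N. f (int (e 1 b)))"
    using assms(7) totient_mult_coprime[OF n(3)] totient_prime[of 3] by (simp add: m totient_def)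
  \<comment> \<open>Only the fibre over 1 modulo 3 carries mass, so the mean of \<open>f\<close> on it is twice the mean on all units,
    that is, more than a half.\<close>
  define g where "g b = 2 * f (int (e 1 b)) - 1" for b
  have g: "g b \<in> {-1..1}" if "b \<in> ?N" for b
    using assms(5) e1(1)[OF that] by (force simp: g_def units)
  have "0 < real (card ?N)" using n(1) by (simp add: card_gt_0_iff)
  then have "0 < average g ?N"
    using sum by (simp add: average_def g_def sum_subtractf sum_distrib_left[symmetric])
  then have "bent_positive (average g ?N) (average g ?N) (average g ?N)"
    by (simp add: bent_positive_def bent_def)
  then obtain a b c where abc: "a \<in> ?N" "b \<in> ?N" "c \<in> ?N" "[a + b + c = nat x] (mod n)"
    and w: "winning (g a) (g b) (g c)"
    using forcesD[OF win, of g g g "nat x"] g by blast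
  have x: "0 \<le> x" "x < int m" using assms(8) by (simp_all add: res_carrier_eq)
  have "[e 1 a + e 1 b + e 1 c = 1 + 1 + 1] (mod 3)"
    using e1(2) abc by (intro cong_add) auto
  moreover have "[nat x = 1 + 1 + 1] (mod 3)"
  proof -
    have "x mod 3 = 0" using assms(9) by (simp add: cong_def)
    then have "nat x mod 3 = 0" using x(1) by presburger
    then show ?thesis by (simp add: cong_def)
  qed
  ultimately have "[e 1 a + e 1 b + e 1 c = nat x] (mod 3)" by (meson cong_sym cong_trans)
  moreover have "[e 1 a + e 1 b + e 1 c = nat x] (mod n)"
    using e1(3)[OF abc(1)] e1(3)[OF abc(2)] e1(3)[OF abc(3)] abc(4) by (meson cong_add cong_trans)
  ultimately have "[e 1 a + e 1 b + e 1 c = nat x] (mod m)"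
    unfolding m using n(3) by (rule coprime_cong_mult_nat)
  then have "[int (e 1 a + e 1 b + e 1 c) = int (nat x)] (mod int m)" by (simp only: cong_int_iff)
  then have "x = int (e 1 a) \<oplus>\<^bsub>?R\<^esub> int (e 1 b) \<oplus>\<^bsub>?R\<^esub> int (e 1 c)"
    using x by (simp add: res_add_eq cong_def mod_add_left_eq)
  moreover have "f (int (e 1 a)) > 0" "f (int (e 1 b)) > 0" "f (int (e 1 c)) > 0"
    "f (int (e 1 a)) + f (int (e 1 b)) + f (int (e 1 c)) > 3 / 2"
    using w by (simp_all add: winning_def g_def)
  ultimately show ?thesis using e1(1) abc units by blast
qed

end
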